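(* Let $A$ be a set of labels and let $\checkmark$ be a fresh symbol. Consider the following functors and semantic structures on $\mathbf{Sets}$. (MC side) $F_S(X)=\mathcal{D}(X+\{\checkmark\})\times A$ (equivalently $\mathcal{D}_{\le 1}(X)\times A$, the missing mass $1-\sum_{x\in X}\sigma(x)$ being the probability $\sigma(\checkmark)$). Semantic domain $\Omega_S=\mathcal{D}_{\le 1,\mathrm{c}}(A^+)$, and $\tau_S\colon F_S(\Omega_S)\to\Omega_S$ given by $\tau_S(\sigma,a)(w)=\sigma(\checkmark)$ if $w=a\in A$; $\tau_S(\sigma,a)(w)=\sum_{\mu\in\Omega_S}\sigma(\mu)\cdot\mu(w')$ if $w=a\cdot w'$ with $w'\in A^+$; and $0$ otherwise. (NFA side) $F_R(Y)=\mathcal{P}_{\mathrm f}(Y+\{\checkmark\})^A$. Semantic domain $\Omega_R=\mathcal{P}(A^+)$, and $\tau_R\colon F_R(\Omega_R)\to\Omega_R$ given by $\tau_R(\delta)=\{a\in A\mid \checkmark\in\delta(a)\}\cup\{a\cdot w\mid a\in A,\ S\in\delta(a),\ w\in S\}$. (Product side) $F_{S\otimes R}(Z)$ is the set of finitely supported functions $Z+\{\checkmark\}\to\mathbb{R}_{\ge0}$, with $F_{S\otimes R}(g)(h)(z')=\sum_{z\in (g+\mathrm{id})^{-1}(z')}h(z)$. Semantic domain $\Omega_{S\otimes R}=\mathbb{R}^\infty_{\ge0}=[0,\infty]$ (with $0\cdot\infty=\infty\cdot 0=0$), and $\tau_{S\otimes R}(\sigma)=\sigma(\checkmark)+\sum_{r\in\mathbb{R}^\infty_{\ge0}}r\cdot\sigma(r)$.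 Let $q\colon\Omega_S\times\Omega_R\to\mathbb{R}^\infty_{\ge0}$ be $q(\sigma,L)=\sum_{w\in L}\sigma(w)$. Then there is no distributive law $\lambda$ from $F_S$ and $F_R$ to $F_{S\otimes R}$, i.e. no family $\lambda_{X,Y}\colon F_S(X)\times F_R(Y)\to F_{S\otimes R}(X\times Y)$ natural in $X$ and $Y$, such that for every MC $c\colon X\to F_SX$ and every NFA $d\colon Y\to F_RY$ ($Y$ finite) the coalgebraic product $c\otimes_\lambda d$ satisfies the correctness criterion with respect to $q$, namely the equation $$q\circ(\tau_S\times\tau_R)=\tau_{S\otimes R}\circ F_{S\otimes R}(q)\circ\lambda_{\Omega_S,\Omega_R}.$$
   Context: $\mathcal{D}$ is the finitely supported probability distribution functor, $\mathcal{D}_{\le 1}$ the finitely supported subdistribution functor, $\mathcal{D}_{\le 1,\mathrm c}$ the countably supported subdistributions, $\mathcal{P}_{\mathrm f}$ the finite (covariant, direct-image) powerset functor, $\mathcal{P}$ the full powerset, and $A^+$ the nonempty finite words over $A$. An MC is a coalgebra $c\colon X\to F_SX$; an NFA is a coalgebra $d\colon Y\to F_RY$ with $Y$ finite. Given a distributive law $\lambda$, the coalgebraic product is $c\otimes_\lambda d=\lambda_{X,Y}\circ(c\times d)\colon X\times Y\to F_{S\otimes R}(X\times Y)$. The correctness criterion with respect to $q$ is the displayed equation of maps $F_S(\Omega_S)\times F_R(\Omega_R)\to\Omega_{S\otimes R}$. *)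

theory Defs
  imports "HOL-Probability.Probability"
begin

text \<open>
  The label set \<open>A\<close> is the type \<open>'a\<close> (so it is nonempty, without which \<open>F_S\<close> would be constantly
  empty), and \<open>A\<^sup>+\<close> is the set of nonempty lists.
  The coproduct with a fresh symbol is rendered by \<open>option\<close>, the fresh symbol being \<open>None\<close>;
  \<open>with_tick X\<close> is the carrier of this coproduct for a set \<open>X\<close>.
  Note that \<open>'x spmf\<close> is the library's abbreviation for \<open>'x option pmf\<close>.
\<close>

definition words :: "'a list set" where
  "words = {w. w \<noteq> []}"

definition with_tick :: "'x set \<Rightarrow> 'x option set" where
  "with_tick X = insert None (Some ` X)"


section \<open>The functors\<close>

text \<open>Each functor is given by its object part (a carrier set) and its action on maps. Elements of
  a carrier are supported in the underlying set, so the action depends only on the values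
  of a map on its domain.\<close>

definition F_S :: "'x set \<Rightarrow> ('x option pmf \<times> 'a) set" where
  "F_S X = {\<sigma>. finite (set_pmf \<sigma>) \<and> set_pmf \<sigma> \<subseteq> with_tick X} \<times> UNIV"

definition F_S_map :: "('x \<Rightarrow> 'y) \<Rightarrow> 'x option pmf \<times> 'a \<Rightarrow> 'y option pmf \<times> 'a" where
  "F_S_map f = map_prod (map_pmf (map_option f)) id"

definition F_R :: "'y set \<Rightarrow> ('a \<Rightarrow> 'y option set) set" where
  "F_R Y = {\<delta>. \<forall>a. finite (\<delta> a) \<and> \<delta> a \<subseteq> with_tick Y}"

definition F_R_map :: "('x \<Rightarrow> 'y) \<Rightarrow> ('a \<Rightarrow> 'x option set) \<Rightarrow> 'a \<Rightarrow> 'y option set" where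
  "F_R_map g \<delta> = (\<lambda>a. map_option g ` \<delta> a)"

text \<open>A function on the coproduct of \<open>Z\<close> with the fresh symbol is extended by zero.\<close>

definition F_SR :: "'z set \<Rightarrow> ('z option \<Rightarrow> real) set" where
  "F_SR Z = {h. (\<forall>z. 0 \<le> h z) \<and> finite {z. h z \<noteq> 0} \<and> {z. h z \<noteq> 0} \<subseteq> with_tick Z}"

text \<open>The sum over a fibre is restricted to the support of \<open>h\<close>, since the library sum over an
  infinite set is zero.\<close>

definition F_SR_map :: "('z \<Rightarrow> 'w) \<Rightarrow> ('z option \<Rightarrow> real) \<Rightarrow> 'w option \<Rightarrow> real" where
  "F_SR_map g h z' = (\<Sum>z | map_option g z = z' \<and> h z \<noteq> 0. h z)"


section \<open>Semantic structures\<close>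

text \<open>Elements of type \<open>'b spmf\<close> always have countable support.\<close>

definition Omega_S :: "'a list spmf set" where
  "Omega_S = {\<mu>. set_spmf \<mu> \<subseteq> words}"

definition Omega_R :: "'a list set set" where
  "Omega_R = Pow words"

fun tau_S_fun :: "'a list spmf option pmf \<times> 'a \<Rightarrow> 'a list \<Rightarrow> real" where
  "tau_S_fun (\<sigma>, a) [] = 0"
| "tau_S_fun (\<sigma>, a) [b] = (if b = a then pmf \<sigma> None else 0)"
| "tau_S_fun (\<sigma>, a) (b # w') =
     (if b = a then \<Sum>\<mu> | Some \<mu> \<in> set_pmf \<sigma>. pmf \<sigma> (Some \<mu>) * spmf \<mu> w' else 0)"

text \<open>The library function \<open>embed_spmf\<close> turns a subprobability mass function into an element
  of the type; that this is one is part of \<open>spmf_tau_S\<close> below.\<close>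

definition tau_S :: "'a list spmf option pmf \<times> 'a \<Rightarrow> 'a list spmf" where
  "tau_S s = embed_spmf (tau_S_fun s)"

definition tau_R :: "('a \<Rightarrow> 'a list set option set) \<Rightarrow> 'a list set" where
  "tau_R \<delta> = {[a] | a. None \<in> \<delta> a} \<union> {a # w | a S w. Some S \<in> \<delta> a \<and> w \<in> S}"

text \<open>The semantic domain of the product side is the whole type \<open>ennreal\<close>, in which
  \<open>0 * \<infinity> = 0\<close>.\<close>

definition tau_SR :: "(ennreal option \<Rightarrow> real) \<Rightarrow> ennreal" where
  "tau_SR \<sigma> = ennreal (\<sigma> None) + (\<Sum>r | \<sigma> (Some r) \<noteq> 0. r * ennreal (\<sigma> (Some r)))"

definition q :: "'a list spmf \<times> 'a list set \<Rightarrow> ennreal" where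
  "q = (\<lambda>(\<sigma>, L). \<Sum>\<^sub>\<infinity>w\<in>L. ennreal (spmf \<sigma> w))"

lemma spmf_tau_S:
  assumes "(\<sigma>, a) \<in> F_S Omega_S"
  shows "spmf (tau_S (\<sigma>, a)) w = tau_S_fun (\<sigma>, a) w"
proof -
  define k where "k = (\<lambda>m. case m of None \<Rightarrow> return_spmf [a] | Some \<mu> \<Rightarrow> map_spmf ((#) a) \<mu>)"
  define p where "p = bind_pmf \<sigma> k"
  have fin: "finite (set_pmf \<sigma>)" and sub: "set_pmf \<sigma> \<subseteq> with_tick Omega_S"
    using assms by (auto simp: F_S_def)
  have fin': "finite {\<mu>. Some \<mu> \<in> set_pmf \<sigma>}"
    using finite_vimageI[OF fin, of Some] by (simp add: vimage_def)
  have split: "spmf p v = pmf \<sigma> None * spmf (k None) v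
      + (\<Sum>\<mu> | Some \<mu> \<in> set_pmf \<sigma>. pmf \<sigma> (Some \<mu>) * spmf (k (Some \<mu>)) v)" for v
  proof -
    have "spmf p v = (\<Sum>m\<in>set_pmf \<sigma>. pmf \<sigma> m * spmf (k m) v)"
      unfolding p_def pmf_bind
      by (subst integral_measure_pmf[OF fin]) auto
    also have "\<dots> = (\<Sum>m\<in>insert None (Some ` {\<mu>. Some \<mu> \<in> set_pmf \<sigma>}). pmf \<sigma> m * spmf (k m) v)"
    proof (rule sum.mono_neutral_left)
      show "set_pmf \<sigma> \<subseteq> insert None (Some ` {\<mu>. Some \<mu> \<in> set_pmf \<sigma>})"
      proof
        fix m assume "m \<in> set_pmf \<sigma>"
        thus "m \<in> insert None (Some ` {\<mu>. Some \<mu> \<in> set_pmf \<sigma>})" by (cases m) auto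
      qed
    qed (use fin' in \<open>auto simp: set_pmf_iff\<close>)
    also have "\<dots> = pmf \<sigma> None * spmf (k None) v
      + (\<Sum>\<mu> | Some \<mu> \<in> set_pmf \<sigma>. pmf \<sigma> (Some \<mu>) * spmf (k (Some \<mu>)) v)"
      using fin' by (simp add: sum.reindex)
    finally show ?thesis .
  qed
  have cons: "spmf (map_spmf ((#) a) \<mu>) (b # v) = (if b = a then spmf \<mu> v else 0)" for \<mu> b v
    by (auto simp: spmf_map_inj' inj_def spmf_eq_0_set_spmf)
  have nil: "spmf (map_spmf ((#) a) \<mu>) [] = 0" for \<mu>
    by (auto simp: spmf_eq_0_set_spmf)
  have words: "spmf \<mu> [] = 0" if "Some \<mu> \<in> set_pmf \<sigma>" for \<mu>
    using that sub by (auto simp: with_tick_def Omega_S_def words_def spmf_eq_0_set_spmf)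
  have p: "spmf p v = tau_S_fun (\<sigma>, a) v" for v
  proof (cases v)
    case Nil
    thus ?thesis by (simp add: split k_def nil)
  next
    case (Cons b v')
    thus ?thesis by (cases v') (auto simp: split k_def cons words)
  qed
  have le: "(\<integral>\<^sup>+ v. ennreal (tau_S_fun (\<sigma>, a) v) \<partial>count_space UNIV) \<le> 1"
    by (simp flip: p add: weight_spmf_eq_nn_integral_spmf[symmetric] weight_spmf_le_1)
  have "spmf (tau_S (\<sigma>, a)) w = max 0 (tau_S_fun (\<sigma>, a) w)"
    unfolding tau_S_def by (rule spmf_embed_spmf[OF le])
  thus ?thesis by (simp flip: p)
qed

lemma tau_S_in_Omega_S:
  assumes "s \<in> F_S Omega_S"
  shows "tau_S s \<in> Omega_S"
proof -
  have "spmf (tau_S s) [] = 0"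
    using assms spmf_tau_S[of "fst s" "snd s" "[]"] by (cases s) simp
  thus ?thesis by (auto simp: Omega_S_def words_def spmf_eq_0_set_spmf)
qed

lemma tau_R_in_Omega_R: "tau_R \<delta> \<in> Omega_R"
  by (auto simp: tau_R_def Omega_R_def words_def)


section \<open>Distributive laws and the correctness criterion\<close>

text \<open>
  The category of sets is rendered by the subsets of a type \<open>'u\<close>, with the functions
  between them, where \<open>'u\<close> is arbitrary except that it has to be large enough
  to contain copies of the two semantic domains (see \<open>component\<close>).
  The functor on the product side is applied to the product type directly, so
  no closure of \<open>'u\<close> under products is needed.
\<close>

type_synonym ('u, 'a) law =
  "'u set \<Rightarrow> 'u set \<Rightarrow> ('u option pmf \<times> 'a) \<times> ('a \<Rightarrow> 'u option set) \<Rightarrow> ('u \<times> 'u) option \<Rightarrow> real"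

definition distributive_law :: "('u, 'a) law \<Rightarrow> bool" where
  "distributive_law lam \<longleftrightarrow>
     (\<forall>X Y. lam X Y \<in> F_S X \<times> F_R Y \<rightarrow> F_SR (X \<times> Y)) \<and>
     (\<forall>X X' Y Y'. \<forall>f \<in> X \<rightarrow> X'. \<forall>g \<in> Y \<rightarrow> Y'. \<forall>t \<in> F_S X \<times> F_R Y.
        lam X' Y' (map_prod (F_S_map f) (F_R_map g) t) = F_SR_map (map_prod f g) (lam X Y t))"

text \<open>The component of \<open>lam\<close> at sets \<open>X\<close> and \<open>Y\<close> of types other than \<open>'u\<close>, transported along
  injections \<open>i\<close> and \<open>j\<close> of these sets into \<open>'u\<close>: first the bijections from \<open>X\<close>, \<open>Y\<close> to their
  images, then \<open>lam\<close> at the images, then back along the inverse bijections.\<close>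

definition component ::
  "('u, 'a) law \<Rightarrow> ('x \<Rightarrow> 'u) \<Rightarrow> ('y \<Rightarrow> 'u) \<Rightarrow> 'x set \<Rightarrow> 'y set \<Rightarrow>
     ('x option pmf \<times> 'a) \<times> ('a \<Rightarrow> 'y option set) \<Rightarrow> ('x \<times> 'y) option \<Rightarrow> real" where
  "component lam i j X Y =
     F_SR_map (map_prod (inv_into X i) (inv_into Y j)) \<circ> lam (i ` X) (j ` Y)
       \<circ> map_prod (F_S_map i) (F_R_map j)"

definition correctness_criterion ::
  "('u, 'a) law \<Rightarrow> ('a list spmf \<Rightarrow> 'u) \<Rightarrow> ('a list set \<Rightarrow> 'u) \<Rightarrow> bool" where
  "correctness_criterion lam i j \<longleftrightarrow>
     (\<forall>t \<in> F_S Omega_S \<times> F_R Omega_R.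
        (q \<circ> map_prod tau_S tau_R) t
          = (tau_SR \<circ> F_SR_map q \<circ> component lam i j Omega_S Omega_R) t)"

text \<open>The coalgebraic product of \<open>c\<close> and \<open>d\<close> is \<open>lam X Y \<circ> map_prod c d\<close>; its correctness criterion
  is the equation above, which mentions neither \<open>c\<close> nor \<open>d\<close>.\<close>

definition MC :: "'u set \<Rightarrow> ('u \<Rightarrow> 'u option pmf \<times> 'a) \<Rightarrow> bool" where
  "MC X c \<longleftrightarrow> c \<in> X \<rightarrow> F_S X"

definition NFA :: "'u set \<Rightarrow> ('u \<Rightarrow> 'a \<Rightarrow> 'u option set) \<Rightarrow> bool" where
  "NFA Y d \<longleftrightarrow> finite Y \<and> d \<in> Y \<rightarrow> F_R Y"

end

theory Submission imports Defs begin

text \<open>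
  Let an MC state \<open>x\<close> with label \<open>a\<close> move surely to \<open>x\<close>, and let an NFA have the two successors
  \<open>y\<^sub>1\<close> and \<open>y\<^sub>2\<close>. Whatever \<open>lam\<close> assigns to this pair is a fixed function \<open>h\<close> on
  \<open>{x} \<times> {y\<^sub>1, y\<^sub>2}\<close> plus the fresh symbol. By naturality the criterion may be evaluated along any
  interpretation of \<open>x\<close>, \<open>y\<^sub>1\<close>, \<open>y\<^sub>2\<close> as semantic objects \<open>\<mu>\<close>, \<open>L\<^sub>1\<close>, \<open>L\<^sub>2\<close>, and it becomes
  \<open>\<mu>(L\<^sub>1 \<union> L\<^sub>2) = h(\<checkmark>) + h(x, y\<^sub>1) \<mu>(L\<^sub>1) + h(x, y\<^sub>2) \<mu>(L\<^sub>2)\<close>. For \<open>\<mu>\<close> the point mass at a word \<open>w\<close>,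
  letting \<open>L\<^sub>1\<close> and \<open>L\<^sub>2\<close> range over \<open>{}\<close> and \<open>{w}\<close> forces both coefficients to be \<open>1\<close>, whence \<open>1 = 2\<close>.
\<close>

text \<open>Functoriality: by finite support, a sum over a fibre of \<open>g \<circ> f\<close> can
  be regrouped by the values of \<open>f\<close>. Values at which the inner sum vanishes contribute
  nothing.\<close>

lemma F_SR_map_compose:
  assumes "h \<in> F_SR Z"
  shows "F_SR_map g (F_SR_map f h) = F_SR_map (g \<circ> f) h"
proof
  fix z'
  let ?T = "{z. map_option (g \<circ> f) z = z' \<and> h z \<noteq> 0}"
  have fin: "finite {z. h z \<noteq> 0}"
    using assms by (simp add: F_SR_def)
  have finT: "finite ?T"
    by (rule finite_subset[OF _ fin]) auto
  have "F_SR_map g (F_SR_map f h) z' = (\<Sum>w \<in> map_option f ` ?T. F_SR_map f h w)"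
    unfolding F_SR_map_def[of g]
  proof (rule sum.mono_neutral_left)
    show "{w. map_option g w = z' \<and> F_SR_map f h w \<noteq> 0} \<subseteq> map_option f ` ?T"
    proof
      fix w assume w: "w \<in> {w. map_option g w = z' \<and> F_SR_map f h w \<noteq> 0}"
      then obtain z where "map_option f z = w" "h z \<noteq> 0"
        unfolding F_SR_map_def mem_Collect_eq using sum.not_neutral_contains_not_neutral by blast
      with w show "w \<in> map_option f ` ?T"
        by (auto simp: option.map_comp)
    qed
  qed (use finT in \<open>auto simp: option.map_comp\<close>)
  also have "\<dots> = (\<Sum>w \<in> map_option f ` ?T. \<Sum>z \<in> {z \<in> ?T. map_option f z = w}. h z)"
    unfolding F_SR_map_def[of f]
  proof (intro sum.cong refl)
    fix w assume "w \<in> map_option f ` ?T"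
    hence "map_option g w = z'"
      by (auto simp: option.map_comp)
    thus "{z. map_option f z = w \<and> h z \<noteq> 0} = {z \<in> ?T. map_option f z = w}"
      by (auto simp flip: option.map_comp)
  qed
  also have "\<dots> = F_SR_map (g \<circ> f) h z'"
    unfolding F_SR_map_def[of "g \<circ> f"] by (rule sum.image_gen[OF finT, symmetric])
  finally show "F_SR_map g (F_SR_map f h) z' = F_SR_map (g \<circ> f) h z'" .
qed

text \<open>Change of variables: integrating \<open>r\<close> against the pushforward of
  \<open>h\<close> is integrating \<open>f\<close> against \<open>h\<close>, so fibres of
  \<open>f\<close> never have to be computed later.\<close>

lemma tau_SR_F_SR_map:
  assumes "h \<in> F_SR Z"
  shows "tau_SR (F_SR_map f h)
    = ennreal (h None) + (\<Sum>z | h (Some z) \<noteq> 0. f z * ennreal (h (Some z)))"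
proof -
  let ?T = "{z. h (Some z) \<noteq> 0}"
  have fin: "finite {z. h z \<noteq> 0}" and nonneg: "\<And>z. 0 \<le> h z"
    using assms by (auto simp: F_SR_def)
  have finT: "finite ?T"
    using finite_vimageI[OF fin, of Some] by (simp add: vimage_def)
  have "{z. z = None \<and> h z \<noteq> 0} = (if h None \<noteq> 0 then {None} else {})"
    by (rule Collect_conv_if)
  hence none: "F_SR_map f h None = h None"
    by (simp add: F_SR_map_def)
  have some: "F_SR_map f h (Some r) = (\<Sum>z \<in> {z \<in> ?T. f z = r}. h (Some z))" for r
  proof -
    have "{z. map_option f z = Some r \<and> h z \<noteq> 0} = Some ` {z \<in> ?T. f z = r}"
      by auto
    thus ?thesis
      by (simp add: F_SR_map_def sum.reindex)
  qed
  have "(\<Sum>r | F_SR_map f h (Some r) \<noteq> 0. r * ennreal (F_SR_map f h (Some r)))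
      = (\<Sum>r \<in> f ` ?T. r * ennreal (F_SR_map f h (Some r)))"
  proof (rule sum.mono_neutral_left)
    show "{r. F_SR_map f h (Some r) \<noteq> 0} \<subseteq> f ` ?T"
    proof
      fix r assume "r \<in> {r. F_SR_map f h (Some r) \<noteq> 0}"
      hence "(\<Sum>z \<in> {z \<in> ?T. f z = r}. h (Some z)) \<noteq> 0"
        unfolding some by (rule CollectD)
      then obtain z where "z \<in> {z \<in> ?T. f z = r}"
        by (rule sum.not_neutral_contains_not_neutral)
      thus "r \<in> f ` ?T"
        by auto
    qed
  qed (use finT in auto)
  also have "\<dots> = (\<Sum>r \<in> f ` ?T. \<Sum>z \<in> {z \<in> ?T. f z = r}. f z * ennreal (h (Some z)))"
  proof (rule sum.cong[OF refl])
    fix r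
    \<comment> \<open>Moving \<open>ennreal\<close> inside the sum requires \<open>h\<close> to be
      nonnegative.\<close>
    have "r * ennreal (F_SR_map f h (Some r)) = (\<Sum>z \<in> {z \<in> ?T. f z = r}. r * ennreal (h (Some z)))"
      unfolding some sum_distrib_left[symmetric] by (simp only: sum_ennreal[OF nonneg])
    also have "\<dots> = (\<Sum>z \<in> {z \<in> ?T. f z = r}. f z * ennreal (h (Some z)))"
      by (rule sum.cong) auto
    finally show "r * ennreal (F_SR_map f h (Some r))
      = (\<Sum>z \<in> {z \<in> ?T. f z = r}. f z * ennreal (h (Some z)))" .
  qed
  also have "\<dots> = (\<Sum>z \<in> ?T. f z * ennreal (h (Some z)))"
    by (rule sum.image_gen[OF finT, symmetric])
  finally show ?thesis
    by (simp add: tau_SR_def none)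
qed

lemma F_SR_map_cong:
  assumes "h \<in> F_SR Z" and "\<And>z. z \<in> Z \<Longrightarrow> f z = g z"
  shows "F_SR_map f h = F_SR_map g h"
proof
  fix z'
  have "map_option f z = map_option g z" if "h z \<noteq> 0" for z
    using assms that by (cases z) (auto simp: F_SR_def with_tick_def)
  hence "{z. map_option f z = z' \<and> h z \<noteq> 0} = {z. map_option g z = z' \<and> h z \<noteq> 0}"
    by auto
  thus "F_SR_map f h z' = F_SR_map g h z'"
    by (simp add: F_SR_map_def)
qed

lemma F_S_map_compose: "F_S_map g (F_S_map f s) = F_S_map (g \<circ> f) s"
  by (cases s) (simp add: F_S_map_def pmf.map_comp o_def option.map_comp)

lemma F_R_map_compose: "F_R_map g (F_R_map f \<delta>) = F_R_map (g \<circ> f) \<delta>"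
  by (simp add: F_R_map_def image_image o_def option.map_comp)

lemma map_option_in_with_tick:
  assumes "f \<in> X \<rightarrow> X'" and "m \<in> with_tick X"
  shows "map_option f m \<in> with_tick X'"
  using assms by (auto simp: with_tick_def)

lemma F_S_map_in_F_S:
  assumes f: "f \<in> X \<rightarrow> X'" and s: "s \<in> F_S X"
  shows "F_S_map f s \<in> F_S X'"
proof (cases s)
  case (Pair \<sigma> a)
  hence "finite (set_pmf \<sigma>)" "set_pmf \<sigma> \<subseteq> with_tick X"
    using s by (simp_all add: F_S_def)
  thus ?thesis
    using map_option_in_with_tick[OF f]
    by (auto simp: Pair F_S_map_def F_S_def simp del: map_option_eq_Some)
qed

lemma F_R_map_in_F_R:
  assumes g: "g \<in> Y \<rightarrow> Y'" and \<delta>: "\<delta> \<in> F_R Y"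
  shows "F_R_map g \<delta> \<in> F_R Y'"
  using \<delta> map_option_in_with_tick[OF g] by (auto simp: F_R_map_def F_R_def)

text \<open>Naturality pulls the criterion back from the semantic domains to \<open>X\<close> and
  \<open>Y\<close>. The point is that \<open>h\<close> depends on neither \<open>f\<close> nor
  \<open>g\<close>, so one \<open>h\<close> must satisfy the equation for all
  interpretations.\<close>

lemma correctness_criterion_along_maps:
  fixes lam :: "('u, 'a) law"
  assumes i: "inj_on i Omega_S" and j: "inj_on j Omega_R"
    and law: "distributive_law lam" and crit: "correctness_criterion lam i j"
    and f: "f \<in> X \<rightarrow> Omega_S" and g: "g \<in> Y \<rightarrow> Omega_R"
    and s: "s \<in> F_S X" and \<delta>: "\<delta> \<in> F_R Y"
  defines "h \<equiv> lam X Y (s, \<delta>)"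
  shows "q (tau_S (F_S_map f s), tau_R (F_R_map g \<delta>))
    = ennreal (h None) + (\<Sum>z | h (Some z) \<noteq> 0. q (map_prod f g z) * ennreal (h (Some z)))"
proof -
  let ?inv = "map_prod (inv_into Omega_S i) (inv_into Omega_R j)"
  let ?fg = "map_prod (i \<circ> f) (j \<circ> g)"
  have h: "h \<in> F_SR (X \<times> Y)"
    using law s \<delta> unfolding distributive_law_def h_def by blast
  have if_jg: "i \<circ> f \<in> X \<rightarrow> i ` Omega_S" "j \<circ> g \<in> Y \<rightarrow> j ` Omega_R"
    using f g by auto
  have "lam (i ` Omega_S) (j ` Omega_R) (map_prod (F_S_map (i \<circ> f)) (F_R_map (j \<circ> g)) (s, \<delta>))
      = F_SR_map ?fg h"
    using law if_jg s \<delta> unfolding distributive_law_def h_def by blast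
  hence nat: "component lam i j Omega_S Omega_R (F_S_map f s, F_R_map g \<delta>)
      = F_SR_map ?inv (F_SR_map ?fg h)"
    by (simp add: component_def F_S_map_compose F_R_map_compose)
  \<comment> \<open>\<open>inv_into\<close> undoes \<open>i\<close> and \<open>j\<close> only on the
    semantic domains; this suffices because \<open>f\<close> and \<open>g\<close> land there and
    \<open>h\<close> lives on \<open>X \<times> Y\<close>.\<close>
  have "F_SR_map ?inv (F_SR_map ?fg h) = F_SR_map (map_prod f g) h"
    unfolding F_SR_map_compose[OF h]
    by (rule F_SR_map_cong[OF h]) (use f g i j in \<open>auto simp: Pi_iff inv_into_f_f\<close>)
  hence "F_SR_map q (component lam i j Omega_S Omega_R (F_S_map f s, F_R_map g \<delta>))
      = F_SR_map (q \<circ> map_prod f g) h"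
    by (simp add: nat F_SR_map_compose[OF h])
  moreover have "(F_S_map f s, F_R_map g \<delta>) \<in> F_S Omega_S \<times> F_R Omega_R"
    using F_S_map_in_F_S[OF f s] F_R_map_in_F_R[OF g \<delta>] by simp
  ultimately have "q (tau_S (F_S_map f s), tau_R (F_R_map g \<delta>))
      = tau_SR (F_SR_map (q \<circ> map_prod f g) h)"
    using crit unfolding correctness_criterion_def by (metis comp_apply map_prod_simp)
  thus ?thesis
    by (simp add: tau_SR_F_SR_map[OF h])
qed

text \<open>Phrased through the mass function because it is also applied to a value of
  \<open>tau_S\<close>, which is known only through its masses.\<close>

lemma q_point_mass:
  assumes "\<And>w. spmf \<mu> w = (if w = v then 1 else 0)"
  shows "q (\<mu>, L) = (if v \<in> L then 1 else 0)"
proof -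
  have "q (\<mu>, L) = (\<Sum>\<^sub>\<infinity>w \<in> L \<inter> {v}. ennreal (spmf \<mu> w))"
    unfolding q_def prod.case by (rule infsum_cong_neutral) (auto simp: assms)
  thus ?thesis
    by (simp add: assms)
qed

lemma spmf_tau_S_point_mass:
  assumes "v \<noteq> []"
  shows "spmf (tau_S (return_pmf (Some (return_spmf v)), a)) w = (if w = a # v then 1 else 0)"
proof -
  have "(return_pmf (Some (return_spmf v)), a) \<in> F_S Omega_S"
    using assms by (auto simp: F_S_def with_tick_def Omega_S_def words_def)
  hence "spmf (tau_S (return_pmf (Some (return_spmf v)), a)) w
      = tau_S_fun (return_pmf (Some (return_spmf v)), a) w"
    by (rule spmf_tau_S)
  thus ?thesis
    \<comment> \<open>This rule splits lists into empty, singleton and longer ones, matching the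
      equations of \<open>tau_S_fun\<close>.\<close>
    using assms by (cases w rule: remdups_adj.cases) (auto simp: set_return_pmf)
qed

theorem theorem5p3:
  fixes i :: "'a list spmf \<Rightarrow> 'u" and j :: "'a list set \<Rightarrow> 'u"
  assumes "inj_on i Omega_S" and "inj_on j Omega_R"
  shows "\<not> (\<exists>lam :: ('u, 'a) law. distributive_law lam \<and>
    (\<forall>(X :: 'u set) (c :: 'u \<Rightarrow> 'u option pmf \<times> 'a) (Y :: 'u set) (d :: 'u \<Rightarrow> 'a \<Rightarrow> 'u option set).
       MC X c \<longrightarrow> NFA Y d \<longrightarrow> correctness_criterion lam i j))"
proof
  assume "\<exists>lam :: ('u, 'a) law. distributive_law lam \<and>
    (\<forall>(X :: 'u set) (c :: 'u \<Rightarrow> 'u option pmf \<times> 'a) (Y :: 'u set) (d :: 'u \<Rightarrow> 'a \<Rightarrow> 'u option set).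
       MC X c \<longrightarrow> NFA Y d \<longrightarrow> correctness_criterion lam i j)"
  then obtain lam :: "('u, 'a) law" where law: "distributive_law lam"
    and all: "\<forall>(X :: 'u set) (c :: 'u \<Rightarrow> 'u option pmf \<times> 'a) (Y :: 'u set) (d :: 'u \<Rightarrow> 'a \<Rightarrow> 'u option set).
      MC X c \<longrightarrow> NFA Y d \<longrightarrow> correctness_criterion lam i j"
    by blast
  \<comment> \<open>The coalgebras on the empty set release the criterion from its
    quantifiers.\<close>
  have "MC {} (undefined :: 'u \<Rightarrow> 'u option pmf \<times> 'a)"
    and "NFA {} (undefined :: 'u \<Rightarrow> 'a \<Rightarrow> 'u option set)"
    by (simp_all add: MC_def NFA_def)
  with all have crit: "correctness_criterion lam i j"
    by blast
  define a :: 'a where "a = undefined"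
  define x where "x = i (return_spmf [a])"
  \<comment> \<open>Injectivity of \<open>j\<close> supplies two distinct elements of
    \<open>'u\<close>, so \<open>?g\<close> below can interpret them independently.\<close>
  define y1 where "y1 = j {}"
  define y2 where "y2 = j {[a]}"
  have "y1 \<noteq> y2"
    using assms(2) by (auto simp: y1_def y2_def Omega_R_def words_def dest: inj_onD)
  define s where "s = (return_pmf (Some x), a)"
  define \<delta> where "\<delta> = (\<lambda>_ :: 'a. {Some y1, Some y2})"
  have s: "s \<in> F_S {x}" and \<delta>: "\<delta> \<in> F_R {y1, y2}"
    by (auto simp: s_def \<delta>_def F_S_def F_R_def with_tick_def)
  define h where "h = lam {x} {y1, y2} (s, \<delta>)"
  have h: "h \<in> F_SR ({x} \<times> {y1, y2})"
    using law s \<delta> unfolding distributive_law_def h_def by blast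
  have eq: "(if [a] \<in> L1 \<union> L2 then 1 else 0) = ennreal (h None)
      + ((if [a] \<in> L1 then 1 else 0) * ennreal (h (Some (x, y1)))
        + (if [a] \<in> L2 then 1 else 0) * ennreal (h (Some (x, y2))))"
    if L: "L1 \<in> Omega_R" "L2 \<in> Omega_R" for L1 L2
  proof -
    let ?f = "\<lambda>_ :: 'u. return_spmf [a]"
    let ?g = "\<lambda>y. if y = y1 then L1 else L2"
    have f: "?f \<in> {x} \<rightarrow> Omega_S" and g: "?g \<in> {y1, y2} \<rightarrow> Omega_R"
      using L by (auto simp: Omega_S_def words_def)
    have S: "F_S_map ?f s = (return_pmf (Some (return_spmf [a])), a)"
      by (simp add: s_def F_S_map_def)
    have R: "F_R_map ?g \<delta> = (\<lambda>_. {Some L1, Some L2})"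
      using \<open>y1 \<noteq> y2\<close> by (simp add: \<delta>_def F_R_map_def)
    \<comment> \<open>One step prepends \<open>a\<close>, so \<open>tau_S\<close> yields the point
      mass at \<open>[a, a]\<close>.\<close>
    have mem: "[a, a] \<in> tau_R (\<lambda>_. {Some L1, Some L2}) \<longleftrightarrow> [a] \<in> L1 \<union> L2"
      by (auto simp: tau_R_def)
    have q1: "q (return_spmf [a], L) = (if [a] \<in> L then 1 else 0)" for L
      by (rule q_point_mass) (simp add: indicator_def)
    have q2: "q (tau_S (F_S_map ?f s), tau_R (F_R_map ?g \<delta>))
        = (if [a] \<in> L1 \<union> L2 then 1 else 0)"
      unfolding S R mem[symmetric] by (rule q_point_mass) (simp add: spmf_tau_S_point_mass)
    have "(\<Sum>z | h (Some z) \<noteq> 0. q (map_prod ?f ?g z) * ennreal (h (Some z)))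
        = (\<Sum>z \<in> {x} \<times> {y1, y2}. q (map_prod ?f ?g z) * ennreal (h (Some z)))"
      by (rule sum.mono_neutral_left) (use h in \<open>auto simp: F_SR_def with_tick_def\<close>)
    also have "\<dots> = (\<Sum>y \<in> {y1, y2}. q (return_spmf [a], ?g y) * ennreal (h (Some (x, y))))"
      using \<open>y1 \<noteq> y2\<close> by simp
    also have "\<dots> = (if [a] \<in> L1 then 1 else 0) * ennreal (h (Some (x, y1)))
        + (if [a] \<in> L2 then 1 else 0) * ennreal (h (Some (x, y2)))"
      using \<open>y1 \<noteq> y2\<close> by (simp add: q1)
    finally show ?thesis
      using correctness_criterion_along_maps[OF assms law crit f g s \<delta>, folded h_def]
      unfolding q2 by simp
  qed
  have L: "{} \<in> Omega_R" "{[a]} \<in> Omega_R"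
    by (auto simp: Omega_R_def words_def)
  \<comment> \<open>Two empty languages isolate \<open>h None\<close>, and one nonempty language
    isolates each coefficient. With both equal to \<open>{[a]}\<close>, the union counts the word
    once but the sum counts it twice.\<close>
  have "ennreal (h None) = 0"
    using eq[OF L(1) L(1)] by simp
  moreover from this have "ennreal (h (Some (x, y1))) = 1" "ennreal (h (Some (x, y2))) = 1"
    using eq[OF L(2) L(1)] eq[OF L(1) L(2)] by simp_all
  ultimately have "(1 :: ennreal) = 1 + 1"
    using eq[OF L(2) L(2)] by simp
  thus False
    by simp
qed

end
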